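(* If $N$ is a Nijenhuis operator on a left-symmetric conformal algebra $A$, then $N$ is also a Nijenhuis operator on its sub-adjacent Lie conformal algebra $g(A)$.
   Context: $A$ is finitely generated as a $\mathbb{C}[\partial]$-module. If $b_\mu a=\sum_k\mu^kx_k$ then $b_{-\partial-\lambda}a=\sum_k(-\partial-\lambda)^kx_k$. A left-symmetric conformal algebra is a $\mathbb{C}[\partial]$-module $A$ with a $\mathbb{C}$-linear map $A\otimes A\to A[\lambda]$, $a\otimes b\mapsto a_\lambda b$, such that $(\partial a)_\lambda b=-\lambda a_\lambda b$, $a_\lambda(\partial b)=(\partial+\lambda)a_\lambda b$ and $(a_\lambda b)_{\lambda+\mu}c-a_\lambda(b_\mu c)=(b_\mu a)_{\lambda+\mu}c-b_\mu(a_\lambda c)$. Its sub-adjacent Lie conformal algebra $g(A)$ is the $\mathbb{C}[\partial]$-module $A$ with $\lambda$-bracket $[a_\lambda b]=a_\lambda b-b_{-\partial-\lambda}a$. A Nijenhuis operator on $A$ is a $\mathbb{C}[\partial]$-module homomorphism $N:A\to A$ with $N(a)_\lambda N(b)=N\big(N(a)_\lambda b+a_\lambda N(b)-N(a_\lambda b)\big)$ for all $a,b\in A$. A Nijenhuis operator on a Lie conformal algebra $R$ is a $\mathbb{C}[\partial]$-module homomorphism $N:R\to R$ with $[N(a)_\lambda N(b)]=N\big([N(a)_\lambda b]+[a_\lambda N(b)]-N([a_\lambda b])\big)$ for all $a,b\in R$. *)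

theory Defs
  imports "HOL-Computational_Algebra.Polynomial"
begin

text \<open>
  A \<open>\<complex>[\<partial>]\<close>-module is a \<^locale>\<open>module\<close> over \<^typ>\<open>complex poly\<close>; the polynomial variable acts as
  \<open>\<partial>\<close>. The space \<open>A[\<lambda>]\<close> is the type \<open>'a poly\<close>, where \<open>pCons 0\<close> is multiplication by \<open>\<lambda>\<close>, and a
  \<open>\<lambda>\<close>-product is a map \<open>pr :: 'a \<Rightarrow> 'a \<Rightarrow> 'a poly\<close> with \<open>pr a b = a\<^sub>\<lambda> b\<close>. Additive maps on \<open>A\<close> are
  extended coefficientwise to \<open>A[\<lambda>]\<close> by \<^const>\<open>map_poly\<close>.
\<close>

definition del :: "(complex poly \<Rightarrow> 'a \<Rightarrow> 'a) \<Rightarrow> 'a \<Rightarrow> 'a"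
  where "del scale x = scale [:0, 1:] x"

definition cscale :: "(complex poly \<Rightarrow> 'a \<Rightarrow> 'a) \<Rightarrow> complex \<Rightarrow> 'a \<Rightarrow> 'a"
  where "cscale scale c x = scale [:c:] x"

text \<open>
  For \<open>p = (\<Sum>k. \<lambda>\<^sup>k x\<^sub>k)\<close>, \<open>subst_op T j p\<close> is \<open>\<Sum>k. T\<^sup>k (j x\<^sub>k)\<close>: the variable is replaced by the
  operator \<open>T\<close> and \<open>j\<close> is applied to the coefficients.
\<close>

definition subst_op :: "('b \<Rightarrow> 'b) \<Rightarrow> ('a \<Rightarrow> 'b) \<Rightarrow> 'a::zero poly \<Rightarrow> 'b::comm_monoid_add"
  where "subst_op T j p = (\<Sum>k\<le>degree p. (T ^^ k) (j (coeff p k)))"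

text \<open>
  \<open>A[\<lambda>,\<mu>]\<close> is \<open>'a poly poly\<close>, with \<open>\<lambda>\<close> the inner and \<open>\<mu>\<close> the outer variable. The next three
  operators are multiplication by \<open>\<lambda>\<close>, by \<open>\<mu>\<close> and by \<open>\<lambda> + \<mu>\<close>.
\<close>

definition mult_lam :: "'a::ab_group_add poly poly \<Rightarrow> 'a poly poly"
  where "mult_lam q = map_poly (pCons 0) q"

definition mult_mu :: "'a::ab_group_add poly poly \<Rightarrow> 'a poly poly"
  where "mult_mu q = pCons 0 q"

definition mult_lam_mu :: "'a::ab_group_add poly poly \<Rightarrow> 'a poly poly"
  where "mult_lam_mu q = mult_lam q + mult_mu q"

text \<open>For an operator \<open>T\<close> on \<open>A[\<lambda>,\<mu>]\<close>, \<open>prod_at pr T a b\<close> is \<open>a\<^sub>T b\<close>.\<close>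

definition prod_at ::
  "('a::ab_group_add \<Rightarrow> 'a \<Rightarrow> 'a poly) \<Rightarrow> ('a poly poly \<Rightarrow> 'a poly poly) \<Rightarrow> 'a \<Rightarrow> 'a \<Rightarrow> 'a poly poly"
  where "prod_at pr T a b = subst_op T (\<lambda>x. [:[:x:]:]) (pr a b)"

text \<open>\<open>nest_left pr S T a b c\<close> is \<open>(a\<^sub>S b)\<^sub>T c\<close> and \<open>nest_right pr S T a b c\<close> is \<open>a\<^sub>S (b\<^sub>T c)\<close>.\<close>

definition nest_left ::
  "('a::ab_group_add \<Rightarrow> 'a \<Rightarrow> 'a poly) \<Rightarrow> ('a poly poly \<Rightarrow> 'a poly poly) \<Rightarrow>
   ('a poly poly \<Rightarrow> 'a poly poly) \<Rightarrow> 'a \<Rightarrow> 'a \<Rightarrow> 'a \<Rightarrow> 'a poly poly"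
  where "nest_left pr S T a b c = subst_op S (\<lambda>x. prod_at pr T x c) (pr a b)"

definition nest_right ::
  "('a::ab_group_add \<Rightarrow> 'a \<Rightarrow> 'a poly) \<Rightarrow> ('a poly poly \<Rightarrow> 'a poly poly) \<Rightarrow>
   ('a poly poly \<Rightarrow> 'a poly poly) \<Rightarrow> 'a \<Rightarrow> 'a \<Rightarrow> 'a \<Rightarrow> 'a poly poly"
  where "nest_right pr S T a b c = subst_op T (\<lambda>x. prod_at pr S a x) (pr b c)"

text \<open>\<open>skew_prod scale pr b a\<close> is \<open>b\<^sub>-\<^sub>\<partial>\<^sub>-\<^sub>\<lambda> a = (\<Sum>k. (-\<partial>-\<lambda>)\<^sup>k x\<^sub>k)\<close> in \<open>A[\<lambda>]\<close>, where
  \<open>b\<^sub>\<mu> a = (\<Sum>k. \<mu>\<^sup>k x\<^sub>k)\<close>.\<close>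

definition skew_prod ::
  "(complex poly \<Rightarrow> 'a::ab_group_add \<Rightarrow> 'a) \<Rightarrow> ('a \<Rightarrow> 'a \<Rightarrow> 'a poly) \<Rightarrow> 'a \<Rightarrow> 'a \<Rightarrow> 'a poly"
  where "skew_prod scale pr b a =
    subst_op (\<lambda>q. - map_poly (del scale) q - pCons 0 q) (\<lambda>x. [:x:]) (pr b a)"

text \<open>A \<open>\<complex>\<close>-linear map \<open>A \<otimes> A \<rightarrow> A[\<lambda>]\<close> (given as a \<open>\<complex>\<close>-bilinear map) that is conformally
  sesquilinear.\<close>

locale sesquilinear_product = module scale
  for scale :: "complex poly \<Rightarrow> 'a::ab_group_add \<Rightarrow> 'a" +
  fixes pr :: "'a \<Rightarrow> 'a \<Rightarrow> 'a poly"
  assumes linear_left: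
      "\<And>b. module_hom (cscale scale) (\<lambda>c. map_poly (cscale scale c)) (\<lambda>a. pr a b)"
    and linear_right:
      "\<And>a. module_hom (cscale scale) (\<lambda>c. map_poly (cscale scale c)) (\<lambda>b. pr a b)"
    and del_left: "\<And>a b. pr (del scale a) b = - pCons 0 (pr a b)"
    and del_right: "\<And>a b. pr a (del scale b) = map_poly (del scale) (pr a b) + pCons 0 (pr a b)"

locale left_symmetric_conformal_algebra = sesquilinear_product +
  assumes left_symmetry: "\<And>a b c.
      nest_left pr mult_lam mult_lam_mu a b c - nest_right pr mult_lam mult_mu a b c =
      nest_left pr mult_mu mult_lam_mu b a c - nest_right pr mult_mu mult_lam b a c"

text \<open>Skew-symmetry is \<open>[a\<^sub>\<lambda> b] = -[b\<^sub>-\<^sub>\<partial>\<^sub>-\<^sub>\<lambda> a]\<close>; the Jacobi identity is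
  \<open>[a\<^sub>\<lambda> [b\<^sub>\<mu> c]] = [[a\<^sub>\<lambda> b]\<^sub>\<lambda>\<^sub>+\<^sub>\<mu> c] + [b\<^sub>\<mu> [a\<^sub>\<lambda> c]]\<close>.\<close>

locale lie_conformal_algebra = sesquilinear_product +
  assumes skew_symmetry: "\<And>a b. pr a b = - skew_prod scale pr b a"
    and jacobi: "\<And>a b c.
      nest_right pr mult_lam mult_mu a b c =
      nest_left pr mult_lam mult_lam_mu a b c + nest_right pr mult_mu mult_lam b a c"

definition subadjacent_bracket ::
  "(complex poly \<Rightarrow> 'a::ab_group_add \<Rightarrow> 'a) \<Rightarrow> ('a \<Rightarrow> 'a \<Rightarrow> 'a poly) \<Rightarrow> 'a \<Rightarrow> 'a \<Rightarrow> 'a poly"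
  where "subadjacent_bracket scale pr a b = pr a b - skew_prod scale pr b a"

locale nijenhuis_left_symmetric = left_symmetric_conformal_algebra +
  fixes N :: "'a \<Rightarrow> 'a"
  assumes hom: "module_hom scale scale N"
    and nijenhuis: "\<And>a b.
      pr (N a) (N b) = map_poly N (pr (N a) b + pr a (N b) - map_poly N (pr a b))"

locale nijenhuis_lie = lie_conformal_algebra +
  fixes N :: "'a \<Rightarrow> 'a"
  assumes hom: "module_hom scale scale N"
    and nijenhuis: "\<And>a b.
      pr (N a) (N b) = map_poly N (pr (N a) b + pr a (N b) - map_poly N (pr a b))"

end

theory Submission imports Defs begin

text \<open>
  Let \<open>\<partial>\<close> act on \<open>A[\<lambda>,\<mu>]\<close> coefficientwise and put \<open>\<nu> = -\<partial> - \<lambda> - \<mu>\<close>. Expanding the brackets, each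
  of the three terms of the Jacobi identity becomes a signed sum of four products of the form
  \<open>x\<^sub>\<alpha> (y\<^sub>\<beta> z)\<close> or \<open>(x\<^sub>\<alpha> y)\<^sub>\<alpha>\<^sub>+\<^sub>\<beta> z\<close>, where the elements \<open>a, b, c\<close> carry the operators \<open>\<lambda>, \<mu>, \<nu>\<close>.
  The twelve terms group into the left-symmetry identities for the pairs \<open>(a, b)\<close>, \<open>(a, c)\<close> and
  \<open>(b, c)\<close>. The last two follow from left symmetry by substituting \<open>\<mu> := \<nu>\<close>, respectively
  \<open>\<lambda> := \<mu>, \<mu> := \<nu>\<close>, which is legitimate as \<open>\<lambda>, \<mu>, \<nu>\<close> commute.

  The Nijenhuis identity transfers because \<open>N\<close> commutes with \<open>\<partial>\<close>, hence with the substitution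
  \<open>\<lambda> \<mapsto> -\<partial> - \<lambda>\<close>.
\<close>

section \<open>Substituting operators for the variable\<close>

lemma additive_funpow:
  fixes T :: "'a::ab_group_add \<Rightarrow> 'a"
  shows "additive T \<Longrightarrow> additive (T ^^ k)"
  by (induction k) (auto simp: additive_def)

lemma additive_map_poly:
  assumes "additive f"
  shows "additive (map_poly f)"
  using assms
  by (auto simp: additive_def intro!: poly_eqI simp: coeff_map_poly additive.zero[OF assms])

lemma additive_pCons_zero: "additive (pCons (0::'a::ab_group_add))"
  by (simp add: additive_def)

lemma map_poly_commute:
  assumes "f 0 = 0" "g 0 = 0" "\<And>x. f (g x) = g (f x)"
  shows "map_poly f (map_poly g p) = map_poly g (map_poly f p)"
  by (rule poly_eqI) (simp add: coeff_map_poly assms)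

lemma subst_op_zero [simp]: "j 0 = 0 \<Longrightarrow> subst_op T j 0 = 0"
  by (simp add: subst_op_def)

text \<open>Horner's rule: additivity lets one \<open>T\<close> be pulled out of the sum, which
  turns the sum up to the degree into a recursion fit for induction. For \<open>p = 0\<close> the
  degree does not rise, and the extra summand is \<open>T (j 0) = 0\<close>.\<close>

lemma subst_op_pCons:
  fixes j :: "'a::ab_group_add \<Rightarrow> 'b::ab_group_add"
  assumes T: "additive T" and j: "j 0 = 0"
  shows "subst_op T j (pCons a p) = j a + T (subst_op T j p)"
proof (cases "p = 0")
  case True
  then show ?thesis
    using j by (cases "a = 0") (simp_all add: subst_op_def additive.zero[OF T])
next
  case False
  then show ?thesis
    by (simp add: subst_op_def sum.atMost_Suc_shift additive.sum[OF T] del: sum.atMost_Suc)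
qed

lemma additive_subst_op:
  fixes j :: "'a::ab_group_add \<Rightarrow> 'b::ab_group_add"
  assumes T: "additive T" and j: "additive j"
  shows "additive (subst_op T j)"
proof
  fix p q
  show "subst_op T j (p + q) = subst_op T j p + subst_op T j q"
  proof (induction p q rule: poly_induct2)
    case 0
    then show ?case by (simp add: additive.zero[OF j])
  next
    case (pCons a p b q)
    then show ?case
      by (simp add: subst_op_pCons[OF T] additive.zero[OF j] additive.add[OF T] additive.add[OF j]
          algebra_simps)
  qed
qed

text \<open>Passing \<open>f\<close> through \<open>T\<close> once gives it for every power, hence
  for each summand.\<close>

lemma subst_op_intertwine:
  assumes f: "additive f" and T: "\<And>v. f (T v) = T' (f v)"
  shows "f (subst_op T j p) = subst_op T' (\<lambda>x. f (j x)) p"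
proof -
  have "f ((T ^^ k) v) = (T' ^^ k) (f v)" for k v
    by (induction k arbitrary: v) (simp_all add: T)
  then show ?thesis
    by (simp add: subst_op_def additive.sum[OF f])
qed

text \<open>On coefficients \<open>j\<close> turns \<open>g\<close> into \<open>Q\<close>, and
  \<open>Q\<close> then moves out past all powers of \<open>T\<close>.\<close>

lemma subst_op_map_poly:
  fixes j :: "'a::ab_group_add \<Rightarrow> 'b::ab_group_add"
  assumes T: "additive T" and j: "additive j" and Q: "additive Q" and g: "g 0 = 0"
    and jg: "\<And>x. j (g x) = Q (j x)" and QT: "\<And>v. T (Q v) = Q (T v)"
  shows "subst_op T j (map_poly g p) = Q (subst_op T j p)"
proof (induction p)
  case 0
  then show ?case by (simp add: additive.zero[OF j] additive.zero[OF Q])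
next
  case (pCons a p)
  then show ?case
    by (simp add: map_poly_pCons g subst_op_pCons[OF T] additive.zero[OF j] jg QT
        additive.add[OF Q])
qed

lemma subst_op_diff_fun:
  fixes j :: "'a::ab_group_add \<Rightarrow> 'b::ab_group_add"
  assumes T: "additive T"
  shows "subst_op T (\<lambda>x. j x - k x) p = subst_op T j p - subst_op T k p"
  by (simp add: subst_op_def additive.diff[OF additive_funpow[OF T]] sum_subtractf)

lemma subst_op_variable:
  "subst_op (pCons 0) (\<lambda>x. [:x:]) p = (p :: 'a::ab_group_add poly)"
  by (induction p) (simp_all add: subst_op_pCons[OF additive_pCons_zero])

section \<open>The substitution \<lambda> \<mapsto> -\<partial> - \<lambda>\<close>

definition swap_var :: "(complex poly \<Rightarrow> 'a::ab_group_add \<Rightarrow> 'a) \<Rightarrow> 'a poly \<Rightarrow> 'a poly"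
  where "swap_var scale =
    subst_op (\<lambda>q. - map_poly (del scale) q - pCons 0 q) (\<lambda>x. [:x:])"

lemma skew_prod_eq: "skew_prod scale pr b a = swap_var scale (pr b a)"
  by (simp add: skew_prod_def swap_var_def)

lemma additive_embed: "additive (\<lambda>x. [:x::'a::ab_group_add:])"
  by (simp add: additive_def)

locale differential_module = module scale
  for scale :: "complex poly \<Rightarrow> 'a::ab_group_add \<Rightarrow> 'a"
begin

lemma additive_del: "additive (del scale)"
  by (simp add: additive_def del_def scale_right_distrib)

lemmas additive_map_del = additive_map_poly[OF additive_del]

lemma additive_skew_op: "additive (\<lambda>q. - map_poly (del scale) q - pCons 0 q)"
  by (simp add: additive_def additive.add[OF additive_map_del])

lemma additive_swap_var: "additive (swap_var scale)"
  unfolding swap_var_def by (rule additive_subst_op[OF additive_skew_op additive_embed])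

lemma del_zero [simp]: "del scale 0 = 0"
  by (rule additive.zero[OF additive_del])

text \<open>Composition of substitutions: if evaluation turns \<partial> on coefficients into
  \<open>Q\<close> and \<lambda> into \<open>T\<close>, it turns -\<partial> - \<lambda> into
  \<open>-Q - T\<close>. The evaluation \<open>subst_op T j\<close> intertwines these two
  operators.\<close>

lemma subst_op_swap_var:
  fixes j :: "'a \<Rightarrow> 'b::ab_group_add"
  assumes T: "additive T" and j: "additive j" and Q: "additive Q"
    and jdel: "\<And>x. j (del scale x) = Q (j x)" and QT: "\<And>v. T (Q v) = Q (T v)"
  shows "subst_op T j (swap_var scale p) = subst_op (\<lambda>v. - Q v - T v) j p"
proof -
  note add = additive_subst_op[OF T j]
  have mp: "subst_op T j (map_poly (del scale) q) = Q (subst_op T j q)" for q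
    by (rule subst_op_map_poly[where T=T and j=j and g="del scale" and Q=Q, OF T j Q del_zero jdel QT])
  have *: "subst_op T j (- map_poly (del scale) q - pCons 0 q)
      = - Q (subst_op T j q) - T (subst_op T j q)" for q
    by (simp add: additive.diff[OF add] additive.minus[OF add] subst_op_pCons[OF T]
        additive.zero[OF j] mp)
  show ?thesis
    unfolding swap_var_def
    by (subst subst_op_intertwine[where f="subst_op T j" and T'="\<lambda>v. - Q v - T v"
        and T="\<lambda>q. - map_poly (del scale) q - pCons 0 q", OF add *])
      (simp add: swap_var_def subst_op_pCons[OF T] additive.zero[OF j] additive.zero[OF T])
qed

lemma swap_var_map_poly:
  assumes f: "additive f" and fdel: "\<And>x. f (del scale x) = del scale (f x)"
  shows "swap_var scale (map_poly f p) = map_poly f (swap_var scale p)"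
proof -
  note fz = additive.zero[OF f] and F = additive_map_poly[OF f]
  show ?thesis
    unfolding swap_var_def
    by (rule subst_op_map_poly[where g=f, OF additive_skew_op additive_embed F fz])
      (simp_all add: map_poly_pCons fz additive.diff[OF F] additive.minus[OF F]
        map_poly_commute[where f=f and g="del scale"] fdel)
qed

lemma swap_var_pCons_zero:
  "swap_var scale (pCons 0 p) = - map_poly (del scale) (swap_var scale p) - pCons 0 (swap_var scale p)"
  by (simp add: swap_var_def subst_op_pCons[OF additive_skew_op])

text \<open>The substitution is an involution because -\<partial> - (-\<partial> - \<lambda>) =
  \<lambda>.\<close>

lemma swap_var_swap_var: "swap_var scale (swap_var scale p) = p"
proof -
  have "subst_op (\<lambda>q. - map_poly (del scale) q - pCons 0 q) (\<lambda>x. [:x:]) (swap_var scale p)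
     = subst_op (\<lambda>v. - map_poly (del scale) v - (- map_poly (del scale) v - pCons 0 v)) (\<lambda>x. [:x:]) p"
    by (rule subst_op_swap_var[OF additive_skew_op additive_embed additive_map_del])
      (simp_all add: map_poly_pCons additive.diff[OF additive_map_del]
        additive.minus[OF additive_map_del])
  then show ?thesis
    by (simp add: swap_var_def subst_op_variable)
qed

lemma del_cscale: "del scale (cscale scale c x) = cscale scale c (del scale x)"
  by (simp add: del_def cscale_def mult.commute)

lemma additive_cscale: "additive (cscale scale c)"
  by (simp add: additive_def cscale_def scale_right_distrib)

section \<open>Operators on \<open>A[\<lambda>,\<mu>]\<close> commuting with \<partial>\<close>

definition "del2 = map_poly (map_poly (del scale))"

lemma additive_del2: "additive del2"
  unfolding del2_def by (rule additive_map_poly[OF additive_map_del])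

definition coeff_op :: "('a poly poly \<Rightarrow> 'a poly poly) \<Rightarrow> bool"
  where "coeff_op T \<longleftrightarrow> additive T \<and> (\<forall>v. T (del2 v) = del2 (T v))"

lemma coeff_op_additive: "coeff_op T \<Longrightarrow> additive T"
  and coeff_op_del2: "coeff_op T \<Longrightarrow> T (del2 v) = del2 (T v)"
  by (auto simp: coeff_op_def)

lemma coeff_op_minus_del2: "coeff_op T \<Longrightarrow> coeff_op (\<lambda>v. - del2 v - T v)"
  using additive_del2
  by (auto simp: coeff_op_def additive.diff[OF additive_del2] additive.minus[OF additive_del2]
      additive_def algebra_simps)

lemma coeff_op_add: "coeff_op S \<Longrightarrow> coeff_op T \<Longrightarrow> coeff_op (\<lambda>v. S v + T v)"
  using additive_del2 by (auto simp: coeff_op_def additive_def algebra_simps)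

lemma coeff_op_mult_lam: "coeff_op mult_lam"
proof -
  have "map_poly (pCons 0) (map_poly (map_poly (del scale)) v)
      = map_poly (map_poly (del scale)) (map_poly (pCons 0) v)" for v
    by (rule map_poly_commute) (simp_all add: map_poly_pCons)
  then show ?thesis
    using additive_map_poly[OF additive_pCons_zero]
    by (simp add: coeff_op_def mult_lam_def additive_def del2_def)
qed

lemma coeff_op_mult_mu: "coeff_op mult_mu"
  by (simp add: coeff_op_def mult_mu_def additive_def del2_def map_poly_pCons)

end

section \<open>The sub-adjacent bracket\<close>

lemma module_hom_additive: "module_hom s1 s2 f \<Longrightarrow> additive f"
  by (simp add: additive_def module_hom.add)

lemma mult_commute: "mult_lam (mult_mu v) = mult_mu (mult_lam v)"
  by (simp add: mult_lam_def mult_mu_def map_poly_pCons)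

lemma additive_embed2: "additive (\<lambda>x. [:[:x::'a::ab_group_add:]:])"
  by (simp add: additive_def)

sublocale sesquilinear_product \<subseteq> differential_module ..

context sesquilinear_product
begin

abbreviation "br \<equiv> subadjacent_bracket scale pr"

lemma br_eq: "br a b = pr a b - swap_var scale (pr b a)"
  by (simp add: subadjacent_bracket_def skew_prod_eq)

lemmas pr_add_left = module_hom.add[OF linear_left]
  and pr_add_right = module_hom.add[OF linear_right]

section \<open>Products and nested brackets with operator subscripts\<close>

lemma additive_prod_at_left: "coeff_op T \<Longrightarrow> additive (\<lambda>x. prod_at pr T x c)"
  and additive_prod_at_right: "coeff_op T \<Longrightarrow> additive (\<lambda>x. prod_at pr T c x)"
  by (auto simp: additive_def prod_at_def pr_add_left pr_add_right
      additive.add[OF additive_subst_op[OF coeff_op_additive additive_embed2]])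

text \<open>Together with \<open>prod_at_del_right\<close>, this identifies the operator
  \<open>Q\<close> needed in \<open>subst_op_swap_var\<close> when an inner product is swapped
  inside an outer one.\<close>

lemma prod_at_del_left:
  assumes T: "coeff_op T"
  shows "prod_at pr T (del scale x) c = - T (prod_at pr T x c)"
  by (simp add: prod_at_def del_left subst_op_pCons[OF coeff_op_additive[OF T]]
      additive.minus[OF additive_subst_op[OF coeff_op_additive[OF T] additive_embed2]]
      del: minus_pCons)

lemma prod_at_del_right:
  assumes T: "coeff_op T"
  shows "prod_at pr T c (del scale x) = del2 (prod_at pr T c x) + T (prod_at pr T c x)"
proof -
  note a = coeff_op_additive[OF T]
  have "subst_op T (\<lambda>x. [:[:x:]:]) (map_poly (del scale) p) = del2 (subst_op T (\<lambda>x. [:[:x:]:]) p)" for p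
    by (rule subst_op_map_poly[where g="del scale", OF a additive_embed2 additive_del2])
      (simp_all add: del2_def map_poly_pCons coeff_op_del2[OF T, unfolded del2_def])
  then show ?thesis
    by (simp add: prod_at_def del_right subst_op_pCons[OF a]
        additive.add[OF additive_subst_op[OF a additive_embed2]])
qed

lemma prod_at_br:
  assumes T: "coeff_op T"
  shows "prod_at br T a b = prod_at pr T a b - prod_at pr (\<lambda>v. - del2 v - T v) b a"
proof -
  note a = coeff_op_additive[OF T]
  have "subst_op T (\<lambda>x. [:[:x:]:]) (swap_var scale p)
      = subst_op (\<lambda>v. - del2 v - T v) (\<lambda>x. [:[:x:]:]) p" for p
    by (rule subst_op_swap_var[OF a additive_embed2 additive_del2])
      (simp_all add: del2_def map_poly_pCons coeff_op_del2[OF T, unfolded del2_def])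
  then show ?thesis
    by (simp add: prod_at_def br_eq additive.diff[OF additive_subst_op[OF a additive_embed2]])
qed

text \<open>For \<open>S\<close> = \<lambda> and \<open>T\<close> = \<mu> the new subscripts are
  \<nu> = -\<partial> - \<lambda> - \<mu> and -\<partial> - \<lambda> = \<mu> + \<nu>.\<close>

lemma nest_right_br:
  assumes S: "coeff_op S" and T: "coeff_op T" and ST: "\<And>v. S (T v) = T (S v)"
  shows "nest_right br S T a b c =
      nest_right pr S T a b c - nest_right pr S (\<lambda>v. - del2 v - S v - T v) a c b
    - (nest_left pr T (\<lambda>v. - del2 v - S v) b c a
      - nest_left pr (\<lambda>v. - del2 v - S v - T v) (\<lambda>v. - del2 v - S v) c b a)"
proof -
  \<comment> \<open>By sesquilinearity, \<partial> on \<open>x\<close> becomes \<partial> +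
    \<open>S\<close> both in the product of \<open>a\<close> with \<open>x\<close> at
    \<open>S\<close> and in the product of \<open>x\<close> with \<open>a\<close> at -\<partial> -
    \<open>S\<close>. One \<open>Q\<close> therefore serves both swaps.\<close>
  let ?S' = "\<lambda>v. - del2 v - S v" and ?Q = "\<lambda>v. del2 v + S v"
  note a = coeff_op_additive[OF T] and S' = coeff_op_minus_del2[OF S]
  have Q: "additive ?Q"
    using additive_del2 coeff_op_additive[OF S] by (auto simp: additive_def algebra_simps)
  have QT: "T (?Q v) = ?Q (T v)" for v
    by (simp add: additive.add[OF a] coeff_op_del2[OF T] ST)
  have 1: "subst_op T (\<lambda>x. prod_at pr S a x) (swap_var scale p)
      = subst_op (\<lambda>v. - del2 v - S v - T v) (\<lambda>x. prod_at pr S a x) p" for p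
    using subst_op_swap_var[where Q="?Q" and T=T and j="\<lambda>x. prod_at pr S a x", OF a additive_prod_at_right[OF S] Q prod_at_del_right[OF S] QT]
    by simp
  have 2: "subst_op T (\<lambda>x. prod_at pr ?S' x a) (swap_var scale p)
      = subst_op (\<lambda>v. - del2 v - S v - T v) (\<lambda>x. prod_at pr ?S' x a) p" for p
    by (subst subst_op_swap_var[where Q="?Q" and T=T and j="\<lambda>x. prod_at pr ?S' x a", OF a additive_prod_at_left[OF S'] Q _ QT])
      (simp_all add: prod_at_del_left[OF S'])
  show ?thesis
    by (simp add: nest_right_def nest_left_def prod_at_br[OF S] subst_op_diff_fun[OF a] br_eq 1 2
        additive.diff[OF additive_subst_op[OF a additive_prod_at_right[OF S]]]
        additive.diff[OF additive_subst_op[OF a additive_prod_at_left[OF S']]])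
qed

text \<open>Here \<open>U\<close> stands for \<lambda> + \<mu> when \<open>S\<close> = \<lambda>, so
  \<open>U - S\<close> is \<mu> and -\<partial> - \<open>U\<close> is \<nu>.\<close>

lemma nest_left_br:
  assumes S: "coeff_op S" and U: "coeff_op U" and SU: "\<And>v. S (U v) = U (S v)"
  shows "nest_left br S U a b c =
      nest_left pr S U a b c - nest_left pr (\<lambda>v. U v - S v) U b a c
    - (nest_right pr (\<lambda>v. - del2 v - U v) S c a b
      - nest_right pr (\<lambda>v. - del2 v - U v) (\<lambda>v. U v - S v) c b a)"
proof -
  \<comment> \<open>In both outer products \<partial> on the inner element becomes
    \<open>-U\<close>: directly on the left, and as \<partial> + (-\<partial> - \<open>U\<close>) on
    the right.\<close>
  let ?U' = "\<lambda>v. - del2 v - U v" and ?Q = "\<lambda>v. - U v"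
  note a = coeff_op_additive[OF S] and U' = coeff_op_minus_del2[OF U]
  have Q: "additive ?Q"
    using coeff_op_additive[OF U] by (auto simp: additive_def algebra_simps)
  have QS: "S (?Q v) = ?Q (S v)" for v
    by (simp add: additive.minus[OF a] SU)
  have 1: "subst_op S (\<lambda>x. prod_at pr U x c) (swap_var scale p)
      = subst_op (\<lambda>v. U v - S v) (\<lambda>x. prod_at pr U x c) p" for p
    using subst_op_swap_var[where Q="?Q" and T=S and j="\<lambda>x. prod_at pr U x c", OF a additive_prod_at_left[OF U] Q prod_at_del_left[OF U] QS]
    by simp
  have 2: "subst_op S (\<lambda>x. prod_at pr ?U' c x) (swap_var scale p)
      = subst_op (\<lambda>v. U v - S v) (\<lambda>x. prod_at pr ?U' c x) p" for p
    by (subst subst_op_swap_var[where Q="?Q" and T=S and j="\<lambda>x. prod_at pr ?U' c x", OF a additive_prod_at_right[OF U'] Q _ QS])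
      (simp_all add: prod_at_del_right[OF U'])
  show ?thesis
    by (simp add: nest_right_def nest_left_def prod_at_br[OF U] subst_op_diff_fun[OF a] br_eq 1 2
        additive.diff[OF additive_subst_op[OF a additive_prod_at_left[OF U]]]
        additive.diff[OF additive_subst_op[OF a additive_prod_at_right[OF U']]])
qed

section \<open>Sesquilinearity and skew-symmetry of the bracket\<close>

lemma sesquilinear_br: "sesquilinear_product scale br"
proof (intro sesquilinear_product.intro sesquilinear_product_axioms.intro module_axioms)
  note sv = additive.add[OF additive_swap_var] additive.diff[OF additive_swap_var]
    additive.minus[OF additive_swap_var]
  note md = additive.add[OF additive_map_del] additive.diff[OF additive_map_del]
    additive.minus[OF additive_map_del]
  note mc = additive.diff[OF additive_map_poly[OF additive_cscale]]
  note ms = module_hom.axioms(1,2)[OF linear_left]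
  have svc: "swap_var scale (map_poly (cscale scale c) p)
      = map_poly (cscale scale c) (swap_var scale p)" for c p
    by (rule swap_var_map_poly[OF additive_cscale]) (simp add: del_cscale)
  note lin = pr_add_left pr_add_right module_hom.scale[OF linear_left]
    module_hom.scale[OF linear_right]
  show "module_hom (cscale scale) (\<lambda>c. map_poly (cscale scale c)) (\<lambda>a. br a b)" for b
    by (intro module_hom.intro module_hom_axioms.intro ms) (simp_all add: br_eq lin sv svc mc)
  show "module_hom (cscale scale) (\<lambda>c. map_poly (cscale scale c)) (\<lambda>b. br a b)" for a
    by (intro module_hom.intro module_hom_axioms.intro ms) (simp_all add: br_eq lin sv svc mc)
  have svd: "swap_var scale (map_poly (del scale) p)
      = map_poly (del scale) (swap_var scale p)" for p
    by (rule swap_var_map_poly[OF additive_del]) simp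
  have pc: "pCons 0 (x - y) = pCons 0 x - pCons 0 y" for x y :: "'a poly"
    by simp
  \<comment> \<open>The substitution sends -\<lambda> to \<partial> + \<lambda> and back, so it
    exchanges the two sesquilinearity rules just as swapping the arguments does.\<close>
  show "br (del scale a) b = - pCons 0 (br a b)" for a b
    by (simp add: br_eq del_left del_right sv svd swap_var_pCons_zero)
  show "br a (del scale b) = map_poly (del scale) (br a b) + pCons 0 (br a b)" for a b
    unfolding br_eq del_left del_right sv swap_var_pCons_zero md pc by simp
qed

lemma br_skew: "br a b = - skew_prod scale br b a"
  by (simp add: skew_prod_eq br_eq additive.diff[OF additive_swap_var] swap_var_swap_var)

end

section \<open>Substitution into left symmetry, and the Jacobi identity\<close>

context left_symmetric_conformal_algebra
begin

text \<open>Evaluation of \<lambda> at \<open>S\<close> and \<mu> at \<open>T\<close> is an additive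
  map that fixes the constants from \<open>A\<close>, so it carries nested products to nested
  products with the new subscripts. It is applied to both sides of
  \<open>left_symmetry\<close>.\<close>

lemma left_symmetry_subst:
  assumes S: "additive S" and T: "additive T" and ST: "\<And>v. S (T v) = T (S v)"
  shows "nest_left pr S (\<lambda>v. S v + T v) a b c - nest_right pr S T a b c =
    nest_left pr T (\<lambda>v. S v + T v) b a c - nest_right pr T S b a c"
proof -
  define \<Phi> where "\<Phi> = subst_op T (subst_op S (\<lambda>x. [:[:x:]:]))"
  have inner: "additive (subst_op S (\<lambda>x. [:[:x:]:]))"
    by (rule additive_subst_op[OF S additive_embed2])
  have \<Phi>: "additive \<Phi>"
    unfolding \<Phi>_def by (rule additive_subst_op[OF T inner])
  \<comment> \<open>The powers of \<open>T\<close> stand outside those of \<open>S\<close>, so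
    pulling \<open>S\<close> to the front uses that the two commute.\<close>
  have lam: "\<Phi> (mult_lam q) = S (\<Phi> q)" for q
    unfolding \<Phi>_def mult_lam_def
    by (rule subst_op_map_poly[where g="pCons 0", OF T inner S]) (simp_all add: subst_op_pCons[OF S] ST)
  have mu: "\<Phi> (mult_mu q) = T (\<Phi> q)" for q
    by (simp add: \<Phi>_def mult_mu_def subst_op_pCons[OF T])
  have lam_mu: "\<Phi> (mult_lam_mu q) = S (\<Phi> q) + T (\<Phi> q)" for q
    by (simp add: mult_lam_mu_def additive.add[OF \<Phi>] lam mu)
  have base: "\<Phi> [:[:x:]:] = [:[:x:]:]" for x
    by (simp add: \<Phi>_def subst_op_pCons[OF T] subst_op_pCons[OF S] additive.zero[OF S]
        additive.zero[OF T])
  have prod: "\<Phi> (prod_at pr U x y) = prod_at pr U' x y" if "\<And>q. \<Phi> (U q) = U' (\<Phi> q)" for U U' x y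
    unfolding prod_at_def by (subst subst_op_intertwine[where f=\<Phi> and T=U and T'=U', OF \<Phi> that]) (simp add: base)
  have left: "\<Phi> (nest_left pr V U x y z) = nest_left pr V' U' x y z"
    if "\<And>q. \<Phi> (V q) = V' (\<Phi> q)" "\<And>q. \<Phi> (U q) = U' (\<Phi> q)" for U U' V V' x y z
    unfolding nest_left_def
    by (subst subst_op_intertwine[where f=\<Phi> and T=V and T'=V', OF \<Phi> that(1)]) (simp add: prod[where U=U and U'=U', OF that(2)])
  have right: "\<Phi> (nest_right pr U V x y z) = nest_right pr U' V' x y z"
    if "\<And>q. \<Phi> (V q) = V' (\<Phi> q)" "\<And>q. \<Phi> (U q) = U' (\<Phi> q)" for U U' V V' x y z
    unfolding nest_right_def
    by (subst subst_op_intertwine[where f=\<Phi> and T=V and T'=V', OF \<Phi> that(1)]) (simp add: prod[where U=U and U'=U', OF that(2)])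
  show ?thesis
    using arg_cong[OF left_symmetry[of a b c], of \<Phi>]
    unfolding additive.diff[OF \<Phi>]
      left[where V=mult_lam and V'=S and U=mult_lam_mu and U'="\<lambda>v. S v + T v", OF lam lam_mu]
      left[where V=mult_mu and V'=T and U=mult_lam_mu and U'="\<lambda>v. S v + T v", OF mu lam_mu]
      right[where V=mult_mu and V'=T and U=mult_lam and U'=S, OF mu lam]
      right[where V=mult_lam and V'=S and U=mult_mu and U'=T, OF lam mu] .
qed

lemma lie_br: "lie_conformal_algebra scale br"
proof -
  let ?D = del2 and ?L = "mult_lam :: 'a poly poly \<Rightarrow> _" and ?M = "mult_mu :: 'a poly poly \<Rightarrow> _"
  note L = coeff_op_mult_lam and M = coeff_op_mult_mu
  let ?Z = "\<lambda>v. - ?D v - ?L v - ?M v"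
  let ?LM = "\<lambda>v. ?L v + ?M v" and ?LZ = "\<lambda>v. - ?D v - ?M v" and ?MZ = "\<lambda>v. - ?D v - ?L v"
  have LM: "coeff_op ?LM" by (rule coeff_op_add[OF L M])
  have Z: "coeff_op ?Z"
    using coeff_op_minus_del2[OF LM] by (simp add: diff_diff_eq)
  note aL = coeff_op_additive[OF L] and aM = coeff_op_additive[OF M]
    and aZ = coeff_op_additive[OF Z]
  have LZ: "?L (?Z v) = ?Z (?L v)" for v
    by (simp add: additive.diff[OF aL] additive.minus[OF aL] coeff_op_del2[OF L] mult_commute)
  have MZ: "?M (?Z v) = ?Z (?M v)" for v
    by (simp add: additive.diff[OF aM] additive.minus[OF aM] coeff_op_del2[OF M] mult_commute)
  \<comment> \<open>Since \<open>?Z\<close> is \<nu>, \<open>?LZ\<close> is \<lambda> + \<nu> and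
    \<open>?MZ\<close> is \<mu> + \<nu>. Bringing subscripts to these forms lets the bracket
    expansions and the left-symmetry identities match syntactically.\<close>
  have eq: "(\<lambda>v. ?L v + ?Z v) = ?LZ" "(\<lambda>v. ?M v + ?Z v) = ?MZ"
    "(\<lambda>v. ?LM v - ?L v) = ?M" "(\<lambda>v. - ?D v - ?LM v) = ?Z"
    "(\<lambda>v. - ?D v - ?M v - ?L v) = ?Z" "mult_lam_mu = ?LM"
    by (auto simp: mult_lam_mu_def)
  have comm: "?L (?LM v) = ?LM (?L v)" for v
    by (simp add: additive.add[OF aL] mult_commute)
  show ?thesis
  proof (rule lie_conformal_algebra.intro[OF sesquilinear_br], unfold_locales)
    show "br a b = - skew_prod scale br b a" for a b
      by (rule br_skew)
    fix a b c
    note ab = left_symmetry_subst[where S=mult_lam and T=mult_mu, OF aL aM mult_commute, of a b c]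
    note ac = left_symmetry_subst[where S=mult_lam and T="?Z", OF aL aZ LZ, of a c b, unfolded eq]
    note bc = left_symmetry_subst[where S=mult_mu and T="?Z", OF aM aZ MZ, of b c a, unfolded eq]
    note e1 = nest_right_br[where S=mult_lam and T=mult_mu, OF L M mult_commute, of a b c]
    note e2 = nest_right_br[where S=mult_mu and T=mult_lam, OF M L mult_commute[symmetric], of b a c, unfolded eq]
    note e3 = nest_left_br[where S=mult_lam and U="?LM", OF L LM comm, of a b c, unfolded eq]
    show "nest_right br mult_lam mult_mu a b c =
        nest_left br mult_lam mult_lam_mu a b c + nest_right br mult_mu mult_lam b a c"
      \<comment> \<open>Each left-symmetry identity is solved for its first left-nested product.
        Once these three are eliminated, the remaining terms cancel.\<close>
      unfolding eq e1 e2 e3 ab[unfolded diff_eq_eq] ac[unfolded diff_eq_eq] bc[unfolded diff_eq_eq]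
      by (simp add: algebra_simps)
  qed
qed

end

section \<open>Transfer of the Nijenhuis identity\<close>

theorem proposition4p10:
  fixes scale :: "complex poly \<Rightarrow> 'a::ab_group_add \<Rightarrow> 'a"
    and lprod :: "'a \<Rightarrow> 'a \<Rightarrow> 'a poly"
    and N :: "'a \<Rightarrow> 'a"
  assumes algebra: "left_symmetric_conformal_algebra scale lprod"
    and finitely_generated: "\<exists>S. finite S \<and> module.span scale S = UNIV"
    and nijenhuis: "nijenhuis_left_symmetric scale lprod N"
  shows "nijenhuis_lie scale (subadjacent_bracket scale lprod) N"
proof -
  interpret nijenhuis_left_symmetric scale lprod N
    by (rule nijenhuis)
  note aN = module_hom_additive[OF hom]
  note mN = additive.diff[OF additive_map_poly[OF aN]] additive.add[OF additive_map_poly[OF aN]]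
  have Ndel: "N (del scale x) = del scale (N x)" for x
    by (simp add: del_def module_hom.scale[OF hom])
  have svN: "swap_var scale (map_poly N p) = map_poly N (swap_var scale p)" for p
    by (rule swap_var_map_poly[where f=N, OF aN Ndel])
  show ?thesis
  proof (rule nijenhuis_lie.intro[OF lie_br], rule nijenhuis_lie_axioms.intro[OF hom])
    fix a b
    show "br (N a) (N b) = map_poly N (br (N a) b + br a (N b) - map_poly N (br a b))"
      \<comment> \<open>The claim is the Nijenhuis identity for \<open>(a, b)\<close> minus the
        swapped identity for \<open>(b, a)\<close>.\<close>
      by (simp add: br_eq nijenhuis mN svN
          additive.diff[OF additive_swap_var] additive.add[OF additive_swap_var])
  qed
qed

end
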